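(* Let $B=\{(0,0),(0,1),(0,3),(2,0)\}$ and define $S_1=\{(1,1),(2,1),(2,2),(2,3),(3,1)\}$, $S_2=\{(1,3),(2,1),(2,2),(2,3),(3,3)\}$, $S_3=\{(1,1),(1,2),(2,2),(3,1),(3,2)\}$, $S_4=\{(1,2),(1,3),(2,2),(3,2),(3,3)\}$, $S_5=\{(1,1),(1,2),(3,1),(3,2)\}$, $S_6=\{(1,2),(1,3),(3,2),(3,3)\}$, $S_7=\{(1,1),(2,1),(2,3),(3,1)\}$, $S_8=\{(1,3),(2,1),(2,3),(3,3)\}$. For $1\le j\le 8$ let $X_j=B\cup S_j$ and $Y_j=\{(y,x):(x,y)\in X_j\}$. Then for every $j\in\{1,\dots,8\}$, $(123,X_j)\sim_{jd}(132,X_j)$ and $(123,Y_j)\sim_{jd}(132,Y_j)$.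
   Context: $S_n$ is the set of permutations $\pi=\pi_1\cdots\pi_n$ of $\{1,\dots,n\}$. A mesh pattern of length $k$ is a pair $(\tau,R)$ with $\tau\in S_k$ and $R\subseteq\{0,\dots,k\}\times\{0,\dots,k\}$ (the set of shaded boxes; box $(a,b)$ is the unit square with lower-left corner $(a,b)$). An occurrence of $(\tau,R)$ in $\pi\in S_n$ is a subsequence $\pi_{i_1}\cdots\pi_{i_k}$, $i_1<\dots<i_k$, order-isomorphic to $\tau$, such that, with $i_0=0$, $i_{k+1}=n+1$, with $v_1<\dots<v_k$ the values $\pi_{i_1},\dots,\pi_{i_k}$ in increasing order, and $v_0=0$, $v_{k+1}=n+1$, for each $(a,b)\in R$ there is no index $m$ with $i_a<m<i_{a+1}$ and $v_b<\pi_m<v_{b+1}$. Two mesh patterns $q_1,q_2$ are jointly equidistributed, written $q_1\sim_{jd}q_2$, if for all nonnegative integers $n,k,\ell$ the number of $\pi\in S_n$ with exactly $k$ occurrences of $q_1$ and $\ell$ occurrences of $q_2$ equals the number of $\pi\in S_n$ with exactly $\ell$ occurrences of $q_1$ and $k$ occurrences of $q_2$. *)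

theory Defs
  imports Main "HOL-Combinatorics.Permutations"
begin

text \<open>
  A triple \<open>(k, \<tau>, R)\<close> stands for the mesh pattern \<open>(\<tau>, R)\<close> of length \<open>k\<close>. Permutations of
  \<open>{1..n}\<close> are functions \<open>\<pi>\<close> with \<open>\<pi> permutes {1..n}\<close>, where \<open>\<pi> m\<close> is the entry \<open>\<pi>\<^sub>m\<close>.
\<close>

type_synonym mesh_pattern = "nat \<times> (nat \<Rightarrow> nat) \<times> (nat \<times> nat) set"

fun wf_mesh_pattern :: "mesh_pattern \<Rightarrow> bool" where
  "wf_mesh_pattern (k, \<tau>, R) \<longleftrightarrow> \<tau> permutes {1..k} \<and> R \<subseteq> {0..k} \<times> {0..k}"

definition one_line :: "nat list \<Rightarrow> nat \<Rightarrow> nat" where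
  "one_line xs m = (if m \<in> {1..length xs} then xs ! (m - 1) else m)"

text \<open>
  An occurrence is recorded by the increasing list \<open>xs\<close> of its indices \<open>i\<^sub>1 < \<dots> < i\<^sub>k\<close>. The
  lists indexed by \<open>i\<close> and \<open>v\<close> below include the boundary values \<open>i\<^sub>0 = v\<^sub>0 = 0\<close> and
  \<open>i\<^sub>k\<^sub>+\<^sub>1 = v\<^sub>k\<^sub>+\<^sub>1 = n + 1\<close>.
\<close>

fun occurrences :: "mesh_pattern \<Rightarrow> nat \<Rightarrow> (nat \<Rightarrow> nat) \<Rightarrow> nat list set" where
  "occurrences (k, \<tau>, R) n \<pi> =
     {xs. length xs = k \<and> sorted_wrt (<) xs \<and> set xs \<subseteq> {1..n} \<and>
       (let i = (!) (0 # xs @ [n + 1]);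
            v = (!) (0 # sort (map \<pi> xs) @ [n + 1])
        in (\<forall>a\<in>{1..k}. \<forall>b\<in>{1..k}. \<pi> (i a) < \<pi> (i b) \<longleftrightarrow> \<tau> a < \<tau> b) \<and>
           (\<forall>(a, b)\<in>R. \<not> (\<exists>m. i a < m \<and> m < i (a + 1) \<and> v b < \<pi> m \<and> \<pi> m < v (b + 1))))}"

definition jointly_equidistributed :: "mesh_pattern \<Rightarrow> mesh_pattern \<Rightarrow> bool"
    (infix "\<sim>\<^sub>j\<^sub>d" 50) where
  "q1 \<sim>\<^sub>j\<^sub>d q2 \<longleftrightarrow>
     (\<forall>n k l.
        card {\<pi>. \<pi> permutes {1..n} \<and> card (occurrences q1 n \<pi>) = k \<and> card (occurrences q2 n \<pi>) = l} =
        card {\<pi>. \<pi> permutes {1..n} \<and> card (occurrences q1 n \<pi>) = l \<and> card (occurrences q2 n \<pi>) = k})"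

definition base_shading :: "(nat \<times> nat) set" where
  "base_shading = {(0,0), (0,1), (0,3), (2,0)}"

text \<open>The sets \<open>S\<^sub>1, \<dots>, S\<^sub>8\<close>; meaningful only for \<open>1 \<le> j \<le> 8\<close>.\<close>

definition extra_shading :: "nat \<Rightarrow> (nat \<times> nat) set" where
  "extra_shading j =
     [{(1,1), (2,1), (2,2), (2,3), (3,1)},
      {(1,3), (2,1), (2,2), (2,3), (3,3)},
      {(1,1), (1,2), (2,2), (3,1), (3,2)},
      {(1,2), (1,3), (2,2), (3,2), (3,3)},
      {(1,1), (1,2), (3,1), (3,2)},
      {(1,2), (1,3), (3,2), (3,3)},
      {(1,1), (2,1), (2,3), (3,1)},
      {(1,3), (2,1), (2,3), (3,3)}] ! (j - 1)"

definition X_shading :: "nat \<Rightarrow> (nat \<times> nat) set" where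
  "X_shading j = base_shading \<union> extra_shading j"

definition Y_shading :: "nat \<Rightarrow> (nat \<times> nat) set" where
  "Y_shading j = {(y, x) | x y. (x, y) \<in> X_shading j}"

lemma one_line_123_permutes: "one_line [1, 2, 3] permutes {1..3}"
proof -
  have "one_line [1, 2, 3] = id"
    by (auto simp: one_line_def fun_eq_iff nth_Cons split: nat.splits)
  then show ?thesis by (simp add: permutes_id)
qed

lemma one_line_132_permutes: "one_line [1, 3, 2] permutes {1..3}"
proof -
  have "one_line [1, 3, 2] = Transposition.transpose 2 3"
    by (auto simp: one_line_def fun_eq_iff nth_Cons Transposition.transpose_def split: nat.splits)
  then show ?thesis by (simp add: permutes_swap_id)
qed

lemma X_shading_subset:
  assumes "j \<in> {1..8}"
  shows "X_shading j \<subseteq> {0..3} \<times> {0..3}"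
proof -
  have "j \<in> {1, 2, 3, 4, 5, 6, 7, 8}" using assms by auto
  then show ?thesis
    by (auto simp: X_shading_def base_shading_def extra_shading_def)
qed

lemma wf_mesh_patterns:
  assumes "j \<in> {1..8}" and "\<tau> \<in> {one_line [1, 2, 3], one_line [1, 3, 2]}"
  shows "wf_mesh_pattern (3, \<tau>, X_shading j)" and "wf_mesh_pattern (3, \<tau>, Y_shading j)"
  using assms X_shading_subset[OF assms(1)] one_line_123_permutes one_line_132_permutes
  by (auto simp: Y_shading_def)

end

theory Submission
  imports Defs
begin

text \<open>
  Because of the shaded boxes \<open>(0,0)\<close> and \<open>(2,0)\<close>, the first entry of an occurrence is a
  left-to-right minimum and no left-to-right minimum lies weakly between the other two entries.
  Reversing every maximal factor between consecutive left-to-right minima therefore exchanges the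
  last two entries of the occurrence, and it keeps all shaded boxes empty because columns 1 and 3
  of the shading agree. So this involution swaps the occurrences of 123 and 132. The transposed
  shadings are reduced to the original ones by passing to inverse permutations.
\<close>

section \<open>Reversing the blocks between marked positions\<close>

text \<open>Each open gap between consecutive marks \<open>s < e\<close> is reflected by sending
  \<open>m\<close> to \<open>s + e - m\<close>. The clause \<open>Max A < m\<close> covers positions
  beyond the last mark, where the set under \<open>Min\<close> would be empty.\<close>

definition flip :: "nat set \<Rightarrow> nat \<Rightarrow> nat" where
  "flip A m = (if m \<in> A \<or> Max A < m then m else Max {a\<in>A. a < m} + Min {a\<in>A. m < a} - m)"

lemma flip_eq:
  assumes "finite A" "s \<in> A" "e \<in> A" "s < m" "m < e" and gap: "\<And>a. a \<in> A \<Longrightarrow> a \<le> s \<or> e \<le> a"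
  shows "flip A m = s + e - m"
proof -
  have "m \<notin> A" using gap[of m] assms by auto
  moreover have "\<not> Max A < m" using Max_ge[OF \<open>finite A\<close> \<open>e \<in> A\<close>] assms by linarith
  moreover have "Max {a\<in>A. a < m} = s"
    using assms gap by (intro Max_eqI) (auto, fastforce)
  moreover have "Min {a\<in>A. m < a} = e"
    using assms gap by (intro Min_eqI) (auto, fastforce)
  ultimately show ?thesis by (simp add: flip_def)
qed

lemma flip_cases:
  assumes "finite A" "0 \<in> A"
  obtains (fixed) "m \<in> A \<or> Max A < m" "flip A m = m"
  | (block) s e where "s \<in> A" "e \<in> A" "s < m" "m < e" "\<And>a. a \<in> A \<Longrightarrow> a \<le> s \<or> e \<le> a"
      "flip A m = s + e - m"
proof (cases "m \<in> A \<or> Max A < m")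
  case True
  then show ?thesis using fixed by (simp add: flip_def)
next
  case False
  let ?L = "{a\<in>A. a < m}" and ?U = "{a\<in>A. m < a}"
  have "0 < m" using False assms by (cases m) auto
  then have "?L \<noteq> {}" using assms by auto
  then have s: "Max ?L \<in> ?L" using assms by (intro Max_in) auto
  have "Max A \<in> A" using assms by (intro Max_in) auto
  then have "Max A \<in> ?U" using False by (cases "m = Max A") auto
  then have e: "Min ?U \<in> ?U" using assms by (intro Min_in) auto
  have gap: "a \<le> Max ?L \<or> Min ?U \<le> a" if "a \<in> A" for a
  proof -
    have "a < m \<or> m < a" using False that by (cases a m rule: linorder_cases) auto
    then show ?thesis using assms that by auto
  qed
  show ?thesis
    using s e by (intro block[OF _ _ _ _ gap flip_eq[OF \<open>finite A\<close> _ _ _ _ gap]]) auto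
qed

lemma flip_marked: "a \<in> A \<Longrightarrow> flip A a = a"
  by (simp add: flip_def)

lemma flip_flip:
  assumes "finite A" "0 \<in> A"
  shows "flip A (flip A m) = m"
proof (cases rule: flip_cases[OF assms, of m, case_names fixed block])
  case (block s e)
  then have "flip A (s + e - m) = s + e - (s + e - m)"
    using \<open>finite A\<close> by (intro flip_eq) auto
  with block show ?thesis by simp
qed simp

text \<open>Reflection maps every gap to itself, so no position crosses a mark.\<close>

lemma flip_less_marked_iff:
  assumes "finite A" "0 \<in> A" "a \<in> A"
  shows "flip A m < a \<longleftrightarrow> m < a"
proof (cases rule: flip_cases[OF assms(1,2), of m, case_names fixed block])
  case (block s e)
  then show ?thesis using block(5)[OF \<open>a \<in> A\<close>] by auto
qed simp

lemma marked_less_flip_iff: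
  assumes "finite A" "0 \<in> A" "a \<in> A"
  shows "a < flip A m \<longleftrightarrow> a < m"
  using flip_less_marked_iff[OF assms, of m] flip_flip[OF assms(1,2), of m] flip_marked[OF assms(3)]
  by (metis linorder_neqE_nat not_less_iff_gr_or_eq)

text \<open>No mark lies from \<open>x\<close> to \<open>y\<close>, so both share one gap and one
  reflection. The second conclusion says that the image interval is again free of marks, which lets
  the lemma be applied to it in turn.\<close>

lemma flip_antimono:
  assumes "finite A" "0 \<in> A" "x < y" "y < Max A" "\<And>a. a \<in> A \<Longrightarrow> a < x \<or> y < a"
  shows "flip A y < flip A x" and "\<And>a. a \<in> A \<Longrightarrow> a < flip A y \<or> flip A x < a"
proof -
  have "\<not> (x \<in> A \<or> Max A < x)" using assms(3,4) assms(5)[of x] by auto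
  then obtain s e where se: "s \<in> A" "e \<in> A" "s < x" "x < e"
    "\<And>a. a \<in> A \<Longrightarrow> a \<le> s \<or> e \<le> a" "flip A x = s + e - x"
    by (metis flip_cases[OF assms(1,2), of x])
  have "y < e" using assms(5)[of e] se by auto
  then have y: "flip A y = s + e - y" using assms(1,3) se by (intro flip_eq) auto
  show "flip A y < flip A x" using y se \<open>y < e\<close> assms(3) by auto
  show "a < flip A y \<or> flip A x < a" if "a \<in> A" for a
    using se(5)[OF that] y se \<open>y < e\<close> assms(3) by auto
qed

lemma flip_permutes:
  assumes "A \<subseteq> {0..n + 1}" "0 \<in> A" "n + 1 \<in> A"
  shows "flip A permutes {1..n}"
proof -
  have fin: "finite A" using assms(1) finite_subset by blast
  have "Max A = n + 1" using assms fin by (intro Max_eqI) auto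
  then have "flip A m = m" if "m \<notin> {1..n}" for m
    using that assms(2,3) by (cases "m = 0 \<or> m = n + 1") (auto simp: flip_def)
  moreover have "\<exists>!x. flip A x = y" for y
    using flip_flip[OF fin assms(2)] by metis
  ultimately show ?thesis by (auto simp: permutes_def)
qed

section \<open>Occurrences of length three\<close>

text \<open>Positions and values are separate lists, so that passing to the inverse permutation
  merely exchanges them and the sorted values can be written out.\<close>

definition mesh_free :: "(nat \<times> nat) set \<Rightarrow> (nat \<Rightarrow> nat) \<Rightarrow> nat list \<Rightarrow> nat list \<Rightarrow> bool" where
  "mesh_free R \<pi> is vs \<longleftrightarrow>
     (\<forall>(a, b)\<in>R. \<forall>m. is ! a < m \<longrightarrow> m < is ! (a + 1) \<longrightarrow> \<not> (vs ! b < \<pi> m \<and> \<pi> m < vs ! (b + 1)))"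

lemma length_3_iff: "length xs = 3 \<longleftrightarrow> (\<exists>x y z. xs = [x, y, z])"
  by (auto simp: numeral_3_eq_3 length_Suc_conv)

lemma atLeastAtMost_1_3: "{Suc 0..3} = {1, 2, 3}"
  by auto

lemma occurrences_123:
  "occurrences (3, one_line [1, 2, 3], R) n \<pi> =
     {[x, y, z] | x y z. 1 \<le> x \<and> x < y \<and> y < z \<and> z \<le> n \<and> \<pi> x < \<pi> y \<and> \<pi> y < \<pi> z \<and>
        mesh_free R \<pi> [0, x, y, z, n + 1] [0, \<pi> x, \<pi> y, \<pi> z, n + 1]}"
  by (auto simp: length_3_iff atLeastAtMost_1_3 one_line_def mesh_free_def Let_def) blast

lemma occurrences_132:
  "occurrences (3, one_line [1, 3, 2], R) n \<pi> =
     {[x, y, z] | x y z. 1 \<le> x \<and> x < y \<and> y < z \<and> z \<le> n \<and> \<pi> x < \<pi> z \<and> \<pi> z < \<pi> y \<and>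
        mesh_free R \<pi> [0, x, y, z, n + 1] [0, \<pi> x, \<pi> z, \<pi> y, n + 1]}"
  by (auto simp: length_3_iff atLeastAtMost_1_3 one_line_def mesh_free_def Let_def) blast

lemma finite_occurrences: "finite (occurrences (k, \<tau>, R) n \<pi>)"
  by (rule finite_subset[OF _ finite_lists_length_eq[of "{1..n}" k]]) (auto simp: Let_def)

text \<open>Mapping the class of \<open>(k, l)\<close> injectively into the finite class of
  \<open>(l, k)\<close> gives one inequality for all \<open>k\<close> and \<open>l\<close>;
  exchanging them gives the other.\<close>

lemma jointly_equidistributedI:
  assumes inj: "\<And>n. inj_on (\<Phi> n) {\<pi>. \<pi> permutes {1..n}}"
    and perm: "\<And>n \<pi>. \<pi> permutes {1..n} \<Longrightarrow> \<Phi> n \<pi> permutes {1..n}"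
    and "\<And>n \<pi>. \<pi> permutes {1..n} \<Longrightarrow> card (occurrences q1 n (\<Phi> n \<pi>)) = card (occurrences q2 n \<pi>)"
    and "\<And>n \<pi>. \<pi> permutes {1..n} \<Longrightarrow> card (occurrences q2 n (\<Phi> n \<pi>)) = card (occurrences q1 n \<pi>)"
  shows "q1 \<sim>\<^sub>j\<^sub>d q2"
  unfolding jointly_equidistributed_def
proof (intro allI)
  fix n k l
  let ?S = "\<lambda>k l. {\<pi>. \<pi> permutes {1..n} \<and> card (occurrences q1 n \<pi>) = k \<and> card (occurrences q2 n \<pi>) = l}"
  have le: "card (?S k l) \<le> card (?S l k)" for k l
  proof (rule card_inj_on_le)
    show "inj_on (\<Phi> n) (?S k l)" by (rule inj_on_subset[OF inj]) auto
    show "\<Phi> n ` ?S k l \<subseteq> ?S l k" using assms by auto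
    show "finite (?S l k)" by (rule finite_subset[OF _ finite_permutations[of "{1..n}"]]) auto
  qed
  show "card (?S k l) = card (?S l k)" using le[of k l] le[of l k] by simp
qed

section \<open>Transposed shadings\<close>

text \<open>Inversion reflects the plot in the diagonal: a point \<open>(m, inv \<pi> m)\<close>
  comes from the point \<open>(inv \<pi> m, m)\<close> of \<open>\<pi>\<close>.\<close>

lemma mesh_free_inv:
  assumes "bij \<pi>" "mesh_free (R\<inverse>) \<pi> is vs"
  shows "mesh_free R (inv \<pi>) vs is"
  unfolding mesh_free_def
proof (clarify)
  fix a b m
  assume "(a, b) \<in> R" "vs ! a < m" "m < vs ! (a + 1)" "is ! b < inv \<pi> m" "inv \<pi> m < is ! (b + 1)"
  moreover have "\<pi> (inv \<pi> m) = m" using assms(1) by (simp add: bij_is_surj surj_f_inv_f)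
  ultimately show False using assms(2) by (fastforce simp: mesh_free_def)
qed

text \<open>Both 123 and 132 are their own inverses, so the sorted values of an occurrence in
  \<open>\<pi>\<close> are the positions of an occurrence of the same pattern in
  \<open>inv \<pi>\<close>.\<close>

lemma card_occurrences_inv_le:
  assumes "\<pi> permutes {1..n}" "\<tau> \<in> {one_line [1, 2, 3], one_line [1, 3, 2]}"
  shows "card (occurrences (3, \<tau>, R\<inverse>) n \<pi>) \<le> card (occurrences (3, \<tau>, R) n (inv \<pi>))"
proof (rule card_inj_on_le)
  have bij: "bij \<pi>" and inv: "\<And>x. inv \<pi> (\<pi> x) = x"
    using permutes_bij[OF assms(1)] by (auto simp: bij_is_inj)
  have range: "1 \<le> \<pi> x \<and> \<pi> x \<le> n \<longleftrightarrow> 1 \<le> x \<and> x \<le> n" for x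
    using permutes_in_image[OF assms(1), of x] by simp
  let ?f = "\<lambda>xs. sort (map \<pi> xs)"
  show "inj_on ?f (occurrences (3, \<tau>, R\<inverse>) n \<pi>)"
  proof (rule inj_on_inverseI)
    fix xs assume "xs \<in> occurrences (3, \<tau>, R\<inverse>) n \<pi>"
    then have "sort xs = xs" by (auto intro!: sorted_sort_id strict_sorted_imp_sorted)
    \<comment> \<open>An occurrence is increasing, hence determined by its multiset of entries: undo
      \<open>\<pi>\<close> on the values and sort.\<close>
    moreover have "mset (map (inv \<pi>) (?f xs)) = mset xs"
      by (simp add: inv multiset.map_comp comp_def)
    ultimately show "sort (map (inv \<pi>) (?f xs)) = xs"
      by (metis properties_for_sort sorted_sort mset_sort)
  qed
  show "?f ` occurrences (3, \<tau>, R\<inverse>) n \<pi> \<subseteq> occurrences (3, \<tau>, R) n (inv \<pi>)"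
  proof (rule image_subsetI)
    fix xs assume xs: "xs \<in> occurrences (3, \<tau>, R\<inverse>) n \<pi>"
    consider "\<tau> = one_line [1, 2, 3]" | "\<tau> = one_line [1, 3, 2]" using assms(2) by blast
    then show "?f xs \<in> occurrences (3, \<tau>, R) n (inv \<pi>)"
    proof cases
      case 1
      with xs obtain x y z where "xs = [x, y, z]" "1 \<le> x" "x < y" "y < z" "z \<le> n"
        "\<pi> x < \<pi> y" "\<pi> y < \<pi> z"
        "mesh_free (R\<inverse>) \<pi> [0, x, y, z, n + 1] [0, \<pi> x, \<pi> y, \<pi> z, n + 1]"
        unfolding 1 occurrences_123 by blast
      then show ?thesis
        unfolding 1 occurrences_123 using range[of x] range[of z] mesh_free_inv[OF bij]
        by (auto simp: inv)
    next
      case 2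
      with xs obtain x y z where "xs = [x, y, z]" "1 \<le> x" "x < y" "y < z" "z \<le> n"
        "\<pi> x < \<pi> z" "\<pi> z < \<pi> y"
        "mesh_free (R\<inverse>) \<pi> [0, x, y, z, n + 1] [0, \<pi> x, \<pi> z, \<pi> y, n + 1]"
        unfolding 2 occurrences_132 by blast
      then show ?thesis
        unfolding 2 occurrences_132 using range[of x] range[of y] mesh_free_inv[OF bij]
        by (auto simp: inv)
    qed
  qed
qed (rule finite_occurrences)

lemma card_occurrences_converse:
  assumes "\<pi> permutes {1..n}" "\<tau> \<in> {one_line [1, 2, 3], one_line [1, 3, 2]}"
  shows "card (occurrences (3, \<tau>, R\<inverse>) n \<pi>) = card (occurrences (3, \<tau>, R) n (inv \<pi>))"
proof (rule antisym)
  have "inv (inv \<pi>) = \<pi>" using permutes_bij[OF assms(1)] by (rule inv_inv_eq)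
  then show "card (occurrences (3, \<tau>, R) n (inv \<pi>)) \<le> card (occurrences (3, \<tau>, R\<inverse>) n \<pi>)"
    using card_occurrences_inv_le[OF permutes_inv[OF assms(1)] assms(2), of "R\<inverse>"] by simp
qed (rule card_occurrences_inv_le[OF assms])

section \<open>Reversal between left-to-right minima\<close>

text \<open>The positions of the left-to-right minima, with \<open>0\<close> and \<open>n + 1\<close> added as sentinels.\<close>

definition lr_min_marks :: "nat \<Rightarrow> (nat \<Rightarrow> nat) \<Rightarrow> nat set" where
  "lr_min_marks n \<pi> = {0, n + 1} \<union> {m\<in>{1..n}. \<forall>l\<in>{1..<m}. \<pi> m < \<pi> l}"

definition reverse_blocks :: "nat \<Rightarrow> (nat \<Rightarrow> nat) \<Rightarrow> nat \<Rightarrow> nat" where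
  "reverse_blocks n \<pi> = \<pi> \<circ> flip (lr_min_marks n \<pi>)"

lemma lr_min_marks_basic:
  "lr_min_marks n \<pi> \<subseteq> {0..n + 1}" "finite (lr_min_marks n \<pi>)"
  "0 \<in> lr_min_marks n \<pi>" "n + 1 \<in> lr_min_marks n \<pi>" "Max (lr_min_marks n \<pi>) = n + 1"
proof -
  show *: "lr_min_marks n \<pi> \<subseteq> {0..n + 1}" "0 \<in> lr_min_marks n \<pi>" "n + 1 \<in> lr_min_marks n \<pi>"
    by (auto simp: lr_min_marks_def)
  then show "finite (lr_min_marks n \<pi>)" using finite_subset by blast
  then show "Max (lr_min_marks n \<pi>) = n + 1" using * by (intro Max_eqI) auto
qed

lemmas flip_marks_permutes = flip_permutes[OF lr_min_marks_basic(1,3,4)]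
lemmas flip_marks_flip = flip_flip[OF lr_min_marks_basic(2,3)]
lemmas flip_marks_less_iff = flip_less_marked_iff[OF lr_min_marks_basic(2,3)]
lemmas marks_less_flip_iff = marked_less_flip_iff[OF lr_min_marks_basic(2,3)]

lemma flip_marks_range: "1 \<le> flip (lr_min_marks n \<pi>) m \<and> flip (lr_min_marks n \<pi>) m \<le> n \<longleftrightarrow> 1 \<le> m \<and> m \<le> n"
  using permutes_in_image[OF flip_marks_permutes, of n \<pi> m] by simp

text \<open>
  A block starts with a left-to-right minimum whose value is smaller than all other entries of the
  block, so reversing the rest of the block creates no new left-to-right minimum.
\<close>

lemma lr_min_marks_reverse_blocks:
  assumes "\<pi> permutes {1..n}"
  shows "lr_min_marks n (reverse_blocks n \<pi>) = lr_min_marks n \<pi>"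
proof (rule antisym)
  let ?A = "lr_min_marks n \<pi>" and ?B = "lr_min_marks n (reverse_blocks n \<pi>)"
  note A = lr_min_marks_basic[where n = n and \<pi> = \<pi>]
  show "?A \<subseteq> ?B"
  proof
    fix m assume m: "m \<in> ?A"
    then consider "m = 0 \<or> m = n + 1" | "m \<in> {1..n}" "\<forall>l\<in>{1..<m}. \<pi> m < \<pi> l"
      by (auto simp: lr_min_marks_def)
    then show "m \<in> ?B"
    proof cases
      case 2
      have "reverse_blocks n \<pi> m < reverse_blocks n \<pi> l" if "l \<in> {1..<m}" for l
      proof -
        have "flip ?A l < m" using flip_marks_less_iff[OF m] that by auto
        moreover have "1 \<le> flip ?A l" using flip_marks_range[of n \<pi> l] that 2(1) by auto
        ultimately show ?thesis using 2(2) by (auto simp: reverse_blocks_def flip_marked[OF m])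
      qed
      with 2 show ?thesis by (auto simp: lr_min_marks_def)
    qed (auto simp: lr_min_marks_def)
  qed
  show "?B \<subseteq> ?A"
  proof (rule subsetI, rule ccontr)
    fix m assume m: "m \<in> ?B" "m \<notin> ?A"
    then have range: "m \<in> {1..n}"
      and min: "\<And>l. 1 \<le> l \<Longrightarrow> l < m \<Longrightarrow> \<pi> (flip ?A m) < \<pi> (flip ?A l)"
      by (auto simp: lr_min_marks_def reverse_blocks_def)
    obtain s e where se: "s \<in> ?A" "e \<in> ?A" "s < m" "m < e"
      "\<And>a. a \<in> ?A \<Longrightarrow> a \<le> s \<or> e \<le> a"
      by (rule flip_cases[OF A(2,3), of m]) (use m range A(5) in auto)
    \<comment> \<open>Position 1 is vacuously a left-to-right minimum, so the mark \<open>s\<close>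
      before \<open>m\<close> is a genuine position and not the sentinel 0.\<close>
    have "1 \<in> ?A" using range by (auto simp: lr_min_marks_def)
    then have "1 \<le> s" using se(4) se(5)[of 1] range by auto
    have *: "\<pi> (flip ?A m) < \<pi> s"
      using min[OF \<open>1 \<le> s\<close> se(3)] by (simp add: flip_marked[OF se(1)])
    have s_less: "s < flip ?A m" using marks_less_flip_iff[OF se(1)] se(3) by simp
    \<comment> \<open>The position \<open>p\<close> of the smallest entry up to
      \<open>flip ?A m\<close> is a left-to-right minimum before \<open>e\<close>, hence at or
      before \<open>s\<close>. Yet its entry is below that of \<open>s\<close>, contradicting that
      \<open>s\<close> is a left-to-right minimum.\<close>
    then have "Min (\<pi> ` {1..flip ?A m}) \<in> \<pi> ` {1..flip ?A m}" by (intro Min_in) auto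
    then obtain p where "p \<in> {1..flip ?A m}" "\<pi> p = Min (\<pi> ` {1..flip ?A m})" by auto
    then have p: "p \<in> {1..flip ?A m}" "\<And>i. i \<in> {1..flip ?A m} \<Longrightarrow> \<pi> p \<le> \<pi> i"
      by auto
    have "\<pi> p < \<pi> s" using p(2)[of "flip ?A m"] * s_less by auto
    have "flip ?A m \<le> n" using flip_marks_range[of n \<pi> m] range by auto
    have "\<pi> p < \<pi> l" if "l \<in> {1..<p}" for l
    proof -
      have "\<pi> p \<noteq> \<pi> l" using permutes_inj[OF assms] that by (auto dest: injD)
      then show ?thesis using p that by (simp add: le_neq_trans)
    qed
    then have "p \<in> ?A" using p(1) \<open>flip ?A m \<le> n\<close> by (auto simp: lr_min_marks_def)
    have "flip ?A m < e" using flip_marks_less_iff[OF se(2)] se(4) by simp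
    then have "p \<le> s" using se(5)[OF \<open>p \<in> ?A\<close>] p(1) by auto
    moreover have "\<pi> s \<le> \<pi> p"
    proof (cases "p = s")
      case False
      have "s \<noteq> n + 1" using s_less \<open>flip ?A m \<le> n\<close> by simp
      then have "\<forall>l\<in>{1..<s}. \<pi> s < \<pi> l" using se(1) \<open>1 \<le> s\<close> by (auto simp: lr_min_marks_def)
      then show ?thesis using p(1) \<open>p \<le> s\<close> False by (simp add: less_imp_le)
    qed simp
    ultimately show False using \<open>\<pi> p < \<pi> s\<close> by simp
  qed
qed

lemma reverse_blocks_permutes:
  "\<pi> permutes {1..n} \<Longrightarrow> reverse_blocks n \<pi> permutes {1..n}"
  unfolding reverse_blocks_def by (intro permutes_compose flip_marks_permutes)

text \<open>The marks survive the reversal, so both rounds use the same \<open>flip\<close>, an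
  involution.\<close>

lemma reverse_blocks_reverse_blocks:
  assumes "\<pi> permutes {1..n}"
  shows "reverse_blocks n (reverse_blocks n \<pi>) = \<pi>"
proof -
  have "reverse_blocks n (reverse_blocks n \<pi>) = reverse_blocks n \<pi> \<circ> flip (lr_min_marks n \<pi>)"
    unfolding reverse_blocks_def[of n "reverse_blocks n \<pi>"] lr_min_marks_reverse_blocks[OF assms] ..
  then show ?thesis by (simp add: reverse_blocks_def fun_eq_iff flip_marks_flip)
qed

text \<open>Columns 1 and 3 must agree because reversing the block of the last two entries carries
  other entries of that block from column 1 to column 3 of the new occurrence, and vice
  versa.\<close>

definition reversible_shading :: "(nat \<times> nat) set \<Rightarrow> bool" where
  "reversible_shading R \<longleftrightarrow> R \<subseteq> {0..3} \<times> {0..3} \<and> (0, 0) \<in> R \<and> (2, 0) \<in> R \<and>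
     (\<forall>b. (1, b) \<in> R \<longleftrightarrow> (3, b) \<in> R)"

text \<open>
  The order of the two larger values \<open>v\<close> and \<open>w\<close> relative to the positions \<open>y\<close> and \<open>z\<close> is left open,
  so that the lemma covers 123 and 132 alike.
\<close>

lemma occurrence_reverse_blocks:
  fixes \<pi> n
  defines "\<rho> \<equiv> flip (lr_min_marks n \<pi>)"
  assumes R: "reversible_shading R" and perm: "\<pi> permutes {1..n}"
    and ord: "1 \<le> x" "x < y" "y < z" "z \<le> n" and val: "\<pi> x < \<pi> y" "\<pi> x < \<pi> z"
    and free: "mesh_free R \<pi> [0, x, y, z, n + 1] [0, \<pi> x, v, w, n + 1]"
  shows "\<rho> x = x" "x < \<rho> z" "\<rho> z < \<rho> y" "\<rho> y \<le> n"
    and "mesh_free R (reverse_blocks n \<pi>) [0, x, \<rho> z, \<rho> y, n + 1] [0, \<pi> x, v, w, n + 1]"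
proof -
  let ?A = "lr_min_marks n \<pi>"
  note A = lr_min_marks_basic[where n = n and \<pi> = \<pi>]
  have pos: "0 < \<pi> m" if "1 \<le> m" "m \<le> n" for m
    using permutes_in_image[OF perm, of m] that by simp
  have col: "\<pi> x \<le> \<pi> m" if "0 < m \<and> m < x \<or> y < m \<and> m < z" for m
  proof -
    have "(0, 0) \<in> R" "(2, 0) \<in> R" using R by (auto simp: reversible_shading_def)
    then have "0 < m \<Longrightarrow> m < x \<Longrightarrow> \<not> (0 < \<pi> m \<and> \<pi> m < \<pi> x)"
      "y < m \<Longrightarrow> m < z \<Longrightarrow> \<not> (0 < \<pi> m \<and> \<pi> m < \<pi> x)"
      using free by (auto simp: mesh_free_def)
    then show ?thesis using that pos[of m] ord by auto
  qed
  have "\<pi> x < \<pi> m" if "m \<in> {1..<x}" for m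
  proof -
    have "\<pi> x \<noteq> \<pi> m" using inj_eq[OF permutes_inj[OF perm], of x m] that by auto
    then show ?thesis using col[of m] that by auto
  qed
  then have x: "x \<in> ?A" using ord by (auto simp: lr_min_marks_def)
  then show \<rho>x: "\<rho> x = x" by (simp add: \<rho>_def flip_marked)
  \<comment> \<open>A left-to-right minimum after \<open>x\<close> has an entry below
    \<open>\<pi> x\<close>, but no entry from \<open>y\<close> to \<open>z\<close> is that small. So
    \<open>y\<close> and \<open>z\<close> lie in one block; \<open>z \<le> n\<close> rules out the
    sentinel.\<close>
  have gap: "a < y \<or> z < a" if "a \<in> ?A" for a
  proof (rule ccontr)
    assume a: "\<not> (a < y \<or> z < a)"
    then have "\<pi> a < \<pi> x" using that ord by (auto simp: lr_min_marks_def)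
    moreover have "\<pi> x \<le> \<pi> a" using col[of a] val a by (cases "a = y \<or> a = z") auto
    ultimately show False by simp
  qed
  have anti: "\<rho> b < \<rho> a" if "y \<le> a" "a < b" "b \<le> z" for a b
    unfolding \<rho>_def
  proof (rule flip_antimono(1)[OF A(2,3) \<open>a < b\<close>])
    show "b < Max ?A" using that(3) ord A(5) by simp
    show "c < a \<or> b < c" if "c \<in> ?A" for c using gap[OF that] \<open>y \<le> a\<close> \<open>b \<le> z\<close> by auto
  qed
  \<comment> \<open>The image interval is free of marks as well, so positions strictly between
    \<open>\<rho> z\<close> and \<open>\<rho> y\<close> come from positions strictly between
    \<open>y\<close> and \<open>z\<close>.\<close>
  have anti': "\<rho> b < \<rho> a" if "\<rho> z \<le> a" "a < b" "b \<le> \<rho> y" for a b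
  proof -
    have "\<rho> y \<le> n" using flip_marks_range[of n \<pi> y] ord by (simp add: \<rho>_def)
    have gap': "c < \<rho> z \<or> \<rho> y < c" if "c \<in> ?A" for c
      unfolding \<rho>_def using that gap A(5) ord by (intro flip_antimono(2)[OF A(2,3)]) auto
    show ?thesis
      unfolding \<rho>_def
    proof (rule flip_antimono(1)[OF A(2,3) \<open>a < b\<close>])
      show "b < Max ?A" using that(3) \<open>\<rho> y \<le> n\<close> A(5) by simp
      show "c < a \<or> b < c" if "c \<in> ?A" for c
        using gap'[OF that] \<open>\<rho> z \<le> a\<close> \<open>b \<le> \<rho> y\<close> by auto
    qed
  qed
  have \<rho>\<rho>: "\<rho> (\<rho> m) = m" for m by (simp add: \<rho>_def flip_marks_flip)
  show "x < \<rho> z" using marks_less_flip_iff[OF x] ord by (simp add: \<rho>_def)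
  show "\<rho> z < \<rho> y" using anti ord by simp
  show "\<rho> y \<le> n" using flip_marks_range[of n \<pi> y] ord by (simp add: \<rho>_def)
  show "mesh_free R (reverse_blocks n \<pi>) [0, x, \<rho> z, \<rho> y, n + 1] [0, \<pi> x, v, w, n + 1]"
    unfolding mesh_free_def
  proof (clarify)
    fix a b m
    let ?is = "[0, x, y, z, n + 1]" and ?js = "[0, x, \<rho> z, \<rho> y, n + 1]"
      and ?vs = "[0, \<pi> x, v, w, n + 1]"
    assume ab: "(a, b) \<in> R" and m: "?js ! a < m" "m < ?js ! (a + 1)"
      and row: "?vs ! b < reverse_blocks n \<pi> m" "reverse_blocks n \<pi> m < ?vs ! (b + 1)"
    \<comment> \<open>The reversed permutation has at \<open>m\<close> the entry of
      \<open>\<pi>\<close> at \<open>\<rho> m\<close>, so the row is unchanged. It suffices that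
      \<open>\<rho> m\<close> falls into a column that is shaded in row \<open>b\<close>.\<close>
    have no: False if "(c, b) \<in> R" "?is ! c < \<rho> m" "\<rho> m < ?is ! (c + 1)" for c
      using bspec[OF free[unfolded mesh_free_def] that(1)] that(2,3) row
      by (simp add: reverse_blocks_def \<rho>_def)
    have range: "1 \<le> \<rho> m \<and> \<rho> m \<le> n \<longleftrightarrow> 1 \<le> m \<and> m \<le> n" and left: "\<rho> m < x \<longleftrightarrow> m < x"
      and right: "x < \<rho> m \<longleftrightarrow> x < m"
      using flip_marks_range flip_marks_less_iff[OF x] marks_less_flip_iff[OF x] by (auto simp: \<rho>_def)
    have "a \<in> {0, 1, 2, 3}" using R ab by (auto simp: reversible_shading_def)
    then consider "a = 0" | "a = 2" | "a = 1 \<or> a = 3" by blast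
    then show False
    proof cases
      case 1
      then show ?thesis using no[of 0] ab m range left ord by auto
    next
      case 2
      then have "\<rho> z < m" "m < \<rho> y" using m by auto
      then have "y < \<rho> m" "\<rho> m < z" using anti'[of m "\<rho> y"] anti'[of "\<rho> z" m] by (auto simp: \<rho>\<rho>)
      then show ?thesis using no[of 2] ab 2 by auto
    next
      case 3
      then have m': "x < m" "m < \<rho> z \<or> \<rho> y < m" "m \<le> n"
        using m \<open>x < \<rho> z\<close> \<open>\<rho> z < \<rho> y\<close> \<open>\<rho> y \<le> n\<close> by auto
      \<comment> \<open>Otherwise \<open>m\<close> would lie weakly between \<open>\<rho> z\<close>
        and \<open>\<rho> y\<close>. So \<open>\<rho> m\<close> falls into column 1 or 3, and both
        are shaded in row \<open>b\<close>.\<close>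
      have "\<rho> m < y \<or> z < \<rho> m"
      proof (rule ccontr)
        assume "\<not> (\<rho> m < y \<or> z < \<rho> m)"
        then have "y \<le> \<rho> m" "\<rho> m \<le> z" by auto
        then have "m \<le> \<rho> y" "\<rho> z \<le> m"
          using anti[of y "\<rho> m"] anti[of "\<rho> m" z] \<rho>\<rho>[of m] by (auto simp: le_less)
        with m' show False by auto
      qed
      moreover have "(1, b) \<in> R" "(3, b) \<in> R" using R ab 3 by (auto simp: reversible_shading_def)
      ultimately show ?thesis using no[of 1] no[of 3] m' range right ord by auto
    qed
  qed
qed

text \<open>The triple \<open>[x, y, z]\<close> goes to \<open>[x, \<rho> z, \<rho> y]\<close>, with
  \<open>\<rho>\<close> the \<open>flip\<close> at the marks, which exchanges the last two entries.
  Doing this twice restores the triple, so the map is injective.\<close>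

lemma card_occurrences_reverse_blocks_le:
  assumes R: "reversible_shading R" and perm: "\<pi> permutes {1..n}"
    and \<tau>: "(\<tau>, \<tau>') = (one_line [1, 2, 3], one_line [1, 3, 2]) \<or>
      (\<tau>, \<tau>') = (one_line [1, 3, 2], one_line [1, 2, 3])"
  shows "card (occurrences (3, \<tau>, R) n \<pi>) \<le> card (occurrences (3, \<tau>', R) n (reverse_blocks n \<pi>))"
proof (rule card_inj_on_le)
  let ?\<rho> = "flip (lr_min_marks n \<pi>)"
  let ?f = "\<lambda>xs. [xs ! 0, ?\<rho> (xs ! 2), ?\<rho> (xs ! 1)]"
  have rev: "reverse_blocks n \<pi> (?\<rho> x) = \<pi> x" for x
    by (simp add: reverse_blocks_def flip_marks_flip)
  show "inj_on ?f (occurrences (3, \<tau>, R) n \<pi>)"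
    by (rule inj_on_inverseI[where g = ?f]) (auto simp: length_3_iff flip_marks_flip)
  show "?f ` occurrences (3, \<tau>, R) n \<pi> \<subseteq> occurrences (3, \<tau>', R) n (reverse_blocks n \<pi>)"
  proof (rule image_subsetI)
    fix xs assume xs: "xs \<in> occurrences (3, \<tau>, R) n \<pi>"
    consider "\<tau> = one_line [1, 2, 3]" "\<tau>' = one_line [1, 3, 2]"
      | "\<tau> = one_line [1, 3, 2]" "\<tau>' = one_line [1, 2, 3]" using \<tau> by blast
    \<comment> \<open>Here \<open>v\<close> and \<open>w\<close> are the two larger values in
      increasing order, which merges both patterns into one case.\<close>
    then obtain x y z v w where xyz: "xs = [x, y, z]"
      and ord: "1 \<le> x" "x < y" "y < z" "z \<le> n" "\<pi> x < \<pi> y" "\<pi> x < \<pi> z"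
      and free: "mesh_free R \<pi> [0, x, y, z, n + 1] [0, \<pi> x, v, w, n + 1]"
      and vw: "v = \<pi> y \<and> w = \<pi> z \<and> v < w \<and> \<tau>' = one_line [1, 3, 2] \<or>
        v = \<pi> z \<and> w = \<pi> y \<and> v < w \<and> \<tau>' = one_line [1, 2, 3]"
    proof cases
      case 1
      with xs obtain x y z where "xs = [x, y, z]" "1 \<le> x" "x < y" "y < z" "z \<le> n"
        "\<pi> x < \<pi> y" "\<pi> y < \<pi> z" "mesh_free R \<pi> [0, x, y, z, n + 1] [0, \<pi> x, \<pi> y, \<pi> z, n + 1]"
        unfolding 1 occurrences_123 by blast
      with 1 show ?thesis by (intro that[of x y z "\<pi> y" "\<pi> z"]) auto
    next
      case 2
      with xs obtain x y z where "xs = [x, y, z]" "1 \<le> x" "x < y" "y < z" "z \<le> n"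
        "\<pi> x < \<pi> z" "\<pi> z < \<pi> y" "mesh_free R \<pi> [0, x, y, z, n + 1] [0, \<pi> x, \<pi> z, \<pi> y, n + 1]"
        unfolding 2 occurrences_132 by blast
      with 2 show ?thesis by (intro that[of x y z "\<pi> z" "\<pi> y"]) auto
    qed
    note occ = occurrence_reverse_blocks[OF R perm ord free]
    have "reverse_blocks n \<pi> x = \<pi> x" using rev[of x] occ(1) by simp
    then have "v = \<pi> y \<and> w = \<pi> z \<and> v < w \<Longrightarrow>
        ?f xs \<in> occurrences (3, one_line [1, 3, 2], R) n (reverse_blocks n \<pi>)"
      "v = \<pi> z \<and> w = \<pi> y \<and> v < w \<Longrightarrow>
        ?f xs \<in> occurrences (3, one_line [1, 2, 3], R) n (reverse_blocks n \<pi>)"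
      unfolding occurrences_123 occurrences_132 using xyz ord occ by (auto simp: rev)
    then show "?f xs \<in> occurrences (3, \<tau>', R) n (reverse_blocks n \<pi>)" using vw by blast
  qed
qed (rule finite_occurrences)

text \<open>One inequality is the previous bound for \<open>\<pi>\<close> with the patterns
  exchanged, the other is the bound for \<open>reverse_blocks n \<pi>\<close>, whose reversal is
  \<open>\<pi>\<close>.\<close>

lemma card_occurrences_reverse_blocks:
  assumes "reversible_shading R" "\<pi> permutes {1..n}"
    and "(\<tau>, \<tau>') = (one_line [1, 2, 3], one_line [1, 3, 2]) \<or>
      (\<tau>, \<tau>') = (one_line [1, 3, 2], one_line [1, 2, 3])"
  shows "card (occurrences (3, \<tau>, R) n (reverse_blocks n \<pi>)) = card (occurrences (3, \<tau>', R) n \<pi>)"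
proof (rule antisym)
  show "card (occurrences (3, \<tau>, R) n (reverse_blocks n \<pi>)) \<le> card (occurrences (3, \<tau>', R) n \<pi>)"
    using card_occurrences_reverse_blocks_le[OF assms(1) reverse_blocks_permutes[OF assms(2)] assms(3)]
    by (simp only: reverse_blocks_reverse_blocks[OF assms(2)])
  show "card (occurrences (3, \<tau>', R) n \<pi>) \<le> card (occurrences (3, \<tau>, R) n (reverse_blocks n \<pi>))"
    using assms by (intro card_occurrences_reverse_blocks_le) auto
qed

section \<open>Joint equidistribution for reversible shadings and their transposes\<close>

lemma jointly_equidistributed_reversible:
  assumes "reversible_shading R"
  shows "(3, one_line [1, 2, 3], R) \<sim>\<^sub>j\<^sub>d (3, one_line [1, 3, 2], R)"
proof (rule jointly_equidistributedI[where \<Phi> = reverse_blocks])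
  show "inj_on (reverse_blocks n) {\<pi>. \<pi> permutes {1..n}}" for n
    by (rule inj_on_inverseI[where g = "reverse_blocks n"]) (simp add: reverse_blocks_reverse_blocks)
qed (use card_occurrences_reverse_blocks[OF assms] in \<open>auto simp: reverse_blocks_permutes
      simp del: occurrences.simps One_nat_def\<close>)

text \<open>Conjugating \<open>reverse_blocks\<close> by inversion gives another involution;
  inversion trades the converse shading for \<open>R\<close> and keeps both patterns.\<close>

lemma jointly_equidistributed_reversible_converse:
  assumes "reversible_shading R"
  shows "(3, one_line [1, 2, 3], R\<inverse>) \<sim>\<^sub>j\<^sub>d (3, one_line [1, 3, 2], R\<inverse>)"
proof (rule jointly_equidistributedI)
  let ?\<Phi> = "\<lambda>n \<pi>. inv (reverse_blocks n (inv \<pi>))"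
  have perm: "reverse_blocks n (inv \<pi>) permutes {1..n}" if "\<pi> permutes {1..n}" for n \<pi>
    using that by (intro reverse_blocks_permutes permutes_inv)
  then show "?\<Phi> n \<pi> permutes {1..n}" if "\<pi> permutes {1..n}" for n \<pi>
    using that by (intro permutes_inv)
  have inv_\<Phi>: "inv (?\<Phi> n \<pi>) = reverse_blocks n (inv \<pi>)" if "\<pi> permutes {1..n}" for n \<pi>
    using permutes_inv_inv[OF perm[OF that]] .
  show "inj_on (?\<Phi> n) {\<pi>. \<pi> permutes {1..n}}" for n
  proof (rule inj_on_inverseI[where g = "?\<Phi> n"])
    fix \<pi> assume "\<pi> \<in> {\<pi>. \<pi> permutes {1..n}}"
    then have "\<pi> permutes {1..n}" by simp
    then show "?\<Phi> n (?\<Phi> n \<pi>) = \<pi>"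
      by (simp only: inv_\<Phi> reverse_blocks_reverse_blocks[OF permutes_inv] permutes_inv_inv)
  qed
  have swap: "card (occurrences (3, \<tau>, R\<inverse>) n (?\<Phi> n \<pi>)) = card (occurrences (3, \<tau>', R\<inverse>) n \<pi>)"
    if \<pi>: "\<pi> permutes {1..n}" and \<tau>: "(\<tau>, \<tau>') = (one_line [1, 2, 3], one_line [1, 3, 2]) \<or>
      (\<tau>, \<tau>') = (one_line [1, 3, 2], one_line [1, 2, 3])" for n \<pi> \<tau> \<tau>'
  proof -
    have "card (occurrences (3, \<tau>, R\<inverse>) n (?\<Phi> n \<pi>)) =
        card (occurrences (3, \<tau>, R) n (reverse_blocks n (inv \<pi>)))"
      using card_occurrences_converse[OF permutes_inv[OF perm[OF \<pi>]], of \<tau> R] \<tau> inv_\<Phi>[OF \<pi>] by auto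
    also have "\<dots> = card (occurrences (3, \<tau>', R) n (inv \<pi>))"
      by (rule card_occurrences_reverse_blocks[OF assms permutes_inv[OF \<pi>] \<tau>])
    also have "\<dots> = card (occurrences (3, \<tau>', R\<inverse>) n \<pi>)"
      using card_occurrences_converse[OF \<pi>, of \<tau>' R] \<tau> by auto
    finally show ?thesis .
  qed
  fix n \<pi> assume \<pi>: "\<pi> permutes {1..n::nat}"
  show "card (occurrences (3, one_line [1, 2, 3], R\<inverse>) n (?\<Phi> n \<pi>)) =
      card (occurrences (3, one_line [1, 3, 2], R\<inverse>) n \<pi>)"
    by (rule swap[OF \<pi>]) simp
  show "card (occurrences (3, one_line [1, 3, 2], R\<inverse>) n (?\<Phi> n \<pi>)) =
      card (occurrences (3, one_line [1, 2, 3], R\<inverse>) n \<pi>)"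
    by (rule swap[OF \<pi>]) simp
qed

lemma reversible_X_shading:
  assumes "j \<in> {1..8}"
  shows "reversible_shading (X_shading j)"
proof -
  have "j \<in> {1, 2, 3, 4, 5, 6, 7, 8}" using assms by auto
  then show ?thesis
    by (auto simp: reversible_shading_def X_shading_def base_shading_def extra_shading_def)
qed

theorem mainTheorem14:
  shows "\<forall>j\<in>{1..8}.
    (3, one_line [1, 2, 3], X_shading j) \<sim>\<^sub>j\<^sub>d (3, one_line [1, 3, 2], X_shading j) \<and>
    (3, one_line [1, 2, 3], Y_shading j) \<sim>\<^sub>j\<^sub>d (3, one_line [1, 3, 2], Y_shading j)"
proof
  fix j :: nat assume "j \<in> {1..8}"
  moreover have "Y_shading j = (X_shading j)\<inverse>" by (auto simp: Y_shading_def)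
  ultimately show "(3, one_line [1, 2, 3], X_shading j) \<sim>\<^sub>j\<^sub>d (3, one_line [1, 3, 2], X_shading j) \<and>
    (3, one_line [1, 2, 3], Y_shading j) \<sim>\<^sub>j\<^sub>d (3, one_line [1, 3, 2], Y_shading j)"
    using jointly_equidistributed_reversible[OF reversible_X_shading]
      jointly_equidistributed_reversible_converse[OF reversible_X_shading] by simp
qed

end
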